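(* The function $$ s\mapsto \frac{\zeta'(s)}{\zeta(s)}+\frac{1}{s-1} $$ is decreasing on the interval $(1,\infty)$.
   Context: $\zeta$ denotes the Riemann zeta function, and $s$ is a real variable. *)

theory Defs
  imports "HOL-Analysis.Analysis"
begin

text \<open>
  The Riemann zeta function at a real argument, given by its Dirichlet series. The series
  converges exactly for \<open>s > 1\<close>; for \<open>s \<le> 1\<close> the value of \<open>suminf\<close> carries no meaning.
  Since the half-line \<open>{1<..}\<close> is open, \<open>deriv zeta s\<close> for \<open>s > 1\<close> depends only on the
  values where the series converges.
\<close>

definition zeta :: "real \<Rightarrow> real" where
  "zeta s = (\<Sum>n. 1 / real (Suc n) powr s)"

end

theory Submission
  imports Defs
begin

text \<open>
  The function in question is the logarithmic derivative of \<open>F s = (s - 1) * zeta s\<close>, so the claim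
  follows once \<open>ln F\<close> is strictly concave on \<open>{1<..}\<close>
  (\<open>strictly_concave_deriv_strict_antimono\<close>).

  Concavity comes from an integral representation. Expanding \<open>x / (exp x - 1)\<close> into a geometric
  series, differentiating it, and integrating termwise against \<open>x powr (s - 1)\<close> gives
  \<open>Gamma s * F s = (\<integral>x>0. x powr (s - 1) * \<phi> x)\<close>, where
  \<open>\<phi> x = - (d/dx) (x / (exp x - 1)) = (exp x * (x - 1) + 1) / (exp x - 1)\<^sup>2\<close>
  (\<open>has_mellin_zeta_kernel\<close>). So \<open>F\<close> is the Mellin transform of \<open>\<phi>\<close> divided by the Gamma function, which
  is the Mellin transform of \<open>exp (- x)\<close>. The kernel \<open>\<phi>\<close> is strictly log-concave
  (\<open>zeta_kernel_strictly_log_concave\<close>); this reduces to an inequality between exponential polynomials.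

  The bridge between the two is a theorem of Borell: the Mellin transform of a log-concave function,
  divided by Gamma, is log-concave (\<open>mellin_over_Gamma_strictly_log_concave\<close>). The proof compares
  \<open>\<phi>\<close> with an exponential \<open>a * exp (- b * x)\<close>, whose normalised transform \<open>a * b powr (- s)\<close> is
  exactly log-linear. Given \<open>s0 < s1 < s2\<close>, the constants \<open>a\<close> and \<open>b\<close> are chosen to match the
  transforms at \<open>s0\<close> and \<open>s2\<close>. By log-concavity the difference has sign pattern \<open>-, +, -\<close>, and a
  combination of the three powers \<open>x powr s0\<close>, \<open>x powr s1\<close>, \<open>x powr s2\<close> with the same sign pattern
  shows that at \<open>s1\<close> the transform of \<open>\<phi>\<close> is the larger one.
\<close>

section \<open>Strictly concave functions of one variable\<close>

text \<open>
  The chord inequality is stated without quotients or convex combinations, so that it can be applied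
  directly to three given points in order.
\<close>

definition strictly_concave_on :: "real set \<Rightarrow> (real \<Rightarrow> real) \<Rightarrow> bool" where
  "strictly_concave_on S f \<longleftrightarrow> (\<forall>x\<in>S. \<forall>y\<in>S. \<forall>z\<in>S. x < y \<longrightarrow> y < z \<longrightarrow>
     (z - y) * f x + (y - x) * f z < (z - x) * f y)"

lemma strictly_concave_onD:
  "strictly_concave_on S f \<Longrightarrow> x \<in> S \<Longrightarrow> y \<in> S \<Longrightarrow> z \<in> S \<Longrightarrow> x < y \<Longrightarrow> y < z \<Longrightarrow>
     (z - y) * f x + (y - x) * f z < (z - x) * f y"
  unfolding strictly_concave_on_def by blast

lemma strictly_concave_on_deriv:
  fixes f f' :: "real \<Rightarrow> real"
  assumes deriv: "\<And>x. 0 < x \<Longrightarrow> (f has_field_derivative f' x) (at x)"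
    and anti: "\<And>x y. 0 < x \<Longrightarrow> x < y \<Longrightarrow> f' y < f' x"
  shows "strictly_concave_on {0<..} f"
  unfolding strictly_concave_on_def
proof (intro ballI impI)
  fix x y z :: real
  assume "x \<in> {0<..}" "x < y" "y < z"
  then have x: "0 < x" by simp
  obtain \<xi> where \<xi>: "x < \<xi>" "\<xi> < y" "f y - f x = (y - x) * f' \<xi>"
    using MVT2[OF \<open>x < y\<close>, of f f'] deriv x by auto
  obtain \<eta> where \<eta>: "y < \<eta>" "\<eta> < z" "f z - f y = (z - y) * f' \<eta>"
    using MVT2[OF \<open>y < z\<close>, of f f'] deriv x \<open>x < y\<close> by auto
  have "f' \<eta> < f' \<xi>" using anti[of \<xi> \<eta>] x \<xi> \<eta> by auto
  then have "(z - y) * (y - x) * f' \<eta> < (z - y) * (y - x) * f' \<xi>"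
    using \<open>x < y\<close> \<open>y < z\<close> by simp
  then have "(y - x) * (f z - f y) < (z - y) * (f y - f x)"
    unfolding \<xi>(3) \<eta>(3) by (simp add: algebra_simps)
  then show "(z - y) * f x + (y - x) * f z < (z - x) * f y"
    by (simp add: algebra_simps)
qed

lemma strictly_concave_on_add_affine:
  assumes "strictly_concave_on S f"
  shows "strictly_concave_on S (\<lambda>x. f x + (a * x + b))"
  unfolding strictly_concave_on_def
proof (intro ballI impI)
  fix x y z assume "x \<in> S" "y \<in> S" "z \<in> S" "x < y" "y < z"
  from strictly_concave_onD[OF assms this]
  show "(z - y) * (f x + (a * x + b)) + (y - x) * (f z + (a * z + b)) < (z - x) * (f y + (a * y + b))"
    by (simp add: algebra_simps)
qed

lemma strictly_concave_pos_between:
  assumes "strictly_concave_on S h" "x \<in> S" "y \<in> S" "z \<in> S" "x < y" "y < z" "0 \<le> h x" "0 \<le> h z"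
  shows "0 < h y"
proof -
  have "0 \<le> (z - y) * h x + (y - x) * h z" using assms by simp
  also have "\<dots> < (z - x) * h y" using strictly_concave_onD assms by blast
  finally show ?thesis using assms by (simp add: zero_less_mult_iff)
qed

text \<open>
  The set where \<open>h\<close> is positive is an interval by \<open>strictly_concave_pos_between\<close>; the cases
  distinguish whether it is empty and whether its endpoints lie inside \<open>{0<..}\<close>. In the first case
  \<open>h\<close> may fail to be negative at the single point \<open>p\<close>, where it touches zero. Outside the closure of
  the interval \<open>h\<close> is even strictly negative, for a zero of \<open>h\<close> there would force \<open>h\<close> to be positive
  between it and the interval.
\<close>

lemma strictly_concave_sign_pattern:
  fixes h :: "real \<Rightarrow> real"
  assumes conc: "strictly_concave_on {0<..} h"
  obtains
    (neg) p where "\<And>x. 0 < x \<Longrightarrow> x \<noteq> p \<Longrightarrow> h x < 0"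
  | (up) p where "0 \<le> p" "\<And>x. p < x \<Longrightarrow> 0 < h x" "\<And>x. 0 < x \<Longrightarrow> x < p \<Longrightarrow> h x < 0"
  | (down) q where "0 < q" "\<And>x. 0 < x \<Longrightarrow> x < q \<Longrightarrow> 0 < h x" "\<And>x. q < x \<Longrightarrow> h x < 0"
  | (bump) p q where "0 < p" "p < q" "\<And>x. p < x \<Longrightarrow> x < q \<Longrightarrow> 0 < h x"
      "\<And>x. 0 < x \<Longrightarrow> x < p \<Longrightarrow> h x < 0" "\<And>x. q < x \<Longrightarrow> h x < 0"
proof -
  define P where "P = {x. 0 < x \<and> 0 < h x}"
  note between = strictly_concave_pos_between[OF conc, simplified]
  show thesis
  proof (cases "P = {}")
    case True
    then have nonpos: "h x \<le> 0" if "0 < x" for x using that by (force simp: P_def)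
    have "x = y" if "0 < x" "0 < y" "h x = 0" "h y = 0" for x y
    proof -
      have False if "0 < x" "x < y" "h x = 0" "h y = 0" for x y
        using between[of x "(x + y) / 2" y] nonpos[of "(x + y) / 2"] that by auto
      then show ?thesis using that by (metis linorder_neqE_linordered_idom)
    qed
    then show thesis using nonpos neg by (metis order_less_le)
  next
    case False
    define p where "p = Inf P"
    have bdd: "bdd_below P" by (auto simp: P_def intro!: bdd_belowI[of _ 0])
    have p0: "0 \<le> p" unfolding p_def by (rule cInf_greatest[OF False]) (auto simp: P_def)
    have below: "h x < 0" if "0 < x" "x < p" for x
    proof (rule ccontr)
      assume "\<not> h x < 0"
      obtain z where z: "z \<in> P" using False by auto
      have "p \<le> z" unfolding p_def by (rule cInf_lower[OF z bdd])
      define y where "y = (x + p) / 2"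
      have "0 < h y" using between[of x y z] that z \<open>p \<le> z\<close> \<open>\<not> h x < 0\<close> by (auto simp: P_def y_def)
      then have "p \<le> y" unfolding p_def using that by (intro cInf_lower[OF _ bdd]) (auto simp: P_def y_def)
      then show False using that by (simp add: y_def)
    qed
    have right: "\<exists>y\<in>P. y < x" if "p < x" for x
      using that cInf_less_iff[OF False bdd] by (auto simp: p_def)
    show thesis
    proof (cases "bdd_above P")
      case unb: False
      have "0 < h x" if "p < x" for x
      proof -
        obtain y where "y \<in> P" "y < x" using right[OF \<open>p < x\<close>] by auto
        obtain z where "z \<in> P" "x < z" using unb by (auto simp: bdd_above_def not_le)
        show ?thesis using between[of y x z] \<open>y \<in> P\<close> \<open>y < x\<close> \<open>z \<in> P\<close> \<open>x < z\<close> by (auto simp: P_def)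
      qed
      then show thesis using up p0 below by blast
    next
      case bddA: True
      define q where "q = Sup P"
      have left: "\<exists>z\<in>P. x < z" if "x < q" for x
        using that less_cSup_iff[OF False bddA] by (auto simp: q_def)
      have inside: "0 < h x" if x: "p < x" "x < q" for x
      proof -
        obtain y where "y \<in> P" "y < x" using right[OF x(1)] by auto
        obtain z where "z \<in> P" "x < z" using left[OF x(2)] by auto
        show ?thesis using between[of y x z] \<open>y \<in> P\<close> \<open>y < x\<close> \<open>z \<in> P\<close> \<open>x < z\<close> by (auto simp: P_def)
      qed
      have q0: "0 < q"
      proof -
        obtain z where z: "z \<in> P" using False by auto
        then have "z \<le> q" unfolding q_def using bddA by (rule cSup_upper)
        then show ?thesis using z by (auto simp: P_def)
      qed
      have above: "h x < 0" if "q < x" for x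
      proof (rule ccontr)
        assume "\<not> h x < 0"
        obtain z where z: "z \<in> P" using False by auto
        have "z \<le> q" unfolding q_def by (rule cSup_upper[OF z bddA])
        define y where "y = (q + x) / 2"
        have "0 < h y" using between[of z y x] that z q0 \<open>z \<le> q\<close> \<open>\<not> h x < 0\<close> by (auto simp: P_def y_def)
        then have "y \<le> q" unfolding q_def using that q0 by (intro cSup_upper[OF _ bddA]) (auto simp: P_def y_def)
        then show False using that by (simp add: y_def)
      qed
      consider "p = 0" | "0 < p" "p < q" | "0 < p" "p = q"
        using p0 cInf_le_cSup[OF False bddA bdd] by (force simp: p_def q_def)
      then show thesis
      proof cases
        case 1 then show thesis using down[of q] inside above q0 by auto
      next
        case 2 then show thesis using bump[of p q] inside above below by blast
      next
        case 3 then show thesis using neg[of p] above below by (metis linorder_neqE_linordered_idom)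
      qed
    qed
  qed
qed

lemma strictly_concave_powr:
  assumes "0 < \<theta>" "\<theta> < 1"
  shows "strictly_concave_on {0<..} (\<lambda>x::real. x powr \<theta>)"
proof (rule strictly_concave_on_deriv)
  show "((\<lambda>x. x powr \<theta>) has_field_derivative \<theta> * x powr (\<theta> - 1)) (at x)" if "0 < x" for x
    using that by (auto intro!: derivative_eq_intros)
  show "\<theta> * y powr (\<theta> - 1) < \<theta> * x powr (\<theta> - 1)" if "0 < x" "x < y" for x y :: real
    using that assms by (intro mult_strict_left_mono powr_less_mono2_neg) auto
qed

text \<open>
  Each derivative value is a slope of a supporting line, and the slopes of the chords over the two
  halves of \<open>{x..z}\<close> differ strictly. Working with the midpoint avoids any strict version of the
  supporting line inequality.
\<close>

lemma strictly_concave_deriv_strict_antimono: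
  fixes f f' :: "real \<Rightarrow> real"
  assumes conc: "strictly_concave_on S f" and S: "convex S" "open S"
    and deriv: "\<And>x. x \<in> S \<Longrightarrow> (f has_field_derivative f' x) (at x)"
  shows "strict_antimono_on S f'"
proof (rule monotone_onI)
  fix x z assume xz: "x \<in> S" "z \<in> S" "x < z"
  have cvx: "convex_on S (\<lambda>x. - f x)"
  proof (rule convex_on_linorderI)
    fix t u w :: real assume t: "0 < t" "t < 1" and uw: "u \<in> S" "w \<in> S" "u < w"
    define m where "m = (1 - t) *\<^sub>R u + t *\<^sub>R w"
    have m: "m - u = t * (w - u)" "w - m = (1 - t) * (w - u)" by (simp_all add: m_def algebra_simps)
    have "0 < m - u" "0 < w - m" unfolding m using t uw by simp_all
    moreover have "m \<in> S" unfolding m_def using S(1) uw t by (intro convexD) auto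
    ultimately have "(w - m) * f u + (m - u) * f w < (w - u) * f m"
      using strictly_concave_onD[OF conc uw(1) _ uw(2), of m] by simp
    then have "(w - u) * ((1 - t) * f u + t * f w) < (w - u) * f m" unfolding m by (simp add: algebra_simps)
    then have "(1 - t) * f u + t * f w < f m" using uw by simp
    then show "- f ((1 - t) *\<^sub>R u + t *\<^sub>R w) \<le> (1 - t) * - f u + t * - f w" by (simp add: m_def)
  qed fact
  have tangent: "f y - f c \<le> f' c * (y - c)" if "c \<in> S" "y \<in> S" for c y
    using convex_on_imp_above_tangent[OF cvx, of c y "- f' c"] that S
      deriv[OF that(1), THEN DERIV_minus, THEN DERIV_subset, of S]
    by (simp add: interior_open convex_connected)
  define y where "y = (x + z) / 2"
  have y: "x < y" "y < z" "y - x = (z - x) / 2" "z - y = (z - x) / 2" using xz by (auto simp: y_def field_simps)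
  have "y \<in> S" using convexD[OF S(1) xz(1,2), of "1/2" "1/2"] by (simp add: y_def field_simps)
  have "(z - x) / 2 * (f x + f z) < (z - x) / 2 * (2 * f y)"
    using strictly_concave_onD[OF conc xz(1) \<open>y \<in> S\<close> xz(2) y(1,2)] unfolding y by (simp add: distrib_left)
  then have "f z - f y < f y - f x" using xz by simp
  moreover have "f y - f x \<le> f' x * ((z - x) / 2)" using tangent[OF xz(1) \<open>y \<in> S\<close>] y by simp
  moreover have "f' z * ((z - x) / 2) \<le> f z - f y"
    using tangent[OF xz(2) \<open>y \<in> S\<close>] y(4) by (simp add: right_diff_distrib flip: y(4))
  ultimately have "f' z * ((z - x) / 2) < f' x * ((z - x) / 2)" by linarith
  then show "f' z < f' x" using xz by simp
qed

section \<open>Mellin transforms\<close>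

text \<open>
  The factor \<open>indicator {0<..} x\<close> confines the integral to the half-line, and the exponent \<open>s - 1\<close>
  makes \<open>Gamma\<close> the transform of \<open>exp (- x)\<close>.
\<close>

definition has_mellin :: "(real \<Rightarrow> real) \<Rightarrow> real \<Rightarrow> real \<Rightarrow> bool" where
  "has_mellin f s M \<longleftrightarrow>
     has_bochner_integral lborel (\<lambda>x. indicator {0<..} x * (x powr (s - 1) * f x)) M"

lemma has_mellin_cong:
  assumes "\<And>x. 0 < x \<Longrightarrow> x powr (s - 1) * f x = x powr (t - 1) * g x"
  shows "has_mellin f s M \<longleftrightarrow> has_mellin g t M"
  unfolding has_mellin_def using assms
  by (intro has_bochner_integral_cong) (auto split: split_indicator)

lemma has_mellin_exp:
  assumes "0 < s" "0 < b"
  shows "has_mellin (\<lambda>x. exp (- (b * x))) s (Gamma s * b powr (- s))"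
proof -
  define F :: "real \<Rightarrow> real" where "F = (\<lambda>x. indicator {0<..} x * (x powr (s - 1) * exp (- x)))"
  have "integral\<^sup>N lborel (\<lambda>x. indicator {0..} x * (x powr (s - 1) / exp x)) = Gamma s"
    by (rule nn_integral_has_integral_lebesgue[OF _ Gamma_integral_real]) (use assms in auto)
  also have "(\<lambda>x. indicator {0..} x * (x powr (s - 1) / exp x)) = F"
    by (auto simp: F_def fun_eq_iff exp_minus field_simps split: split_indicator)
  finally have "has_bochner_integral lborel F (Gamma s)"
    by (intro has_bochner_integral_nn_integral)
       (use assms in \<open>auto simp: F_def intro: Gamma_real_pos less_imp_le\<close>)
  then have "has_bochner_integral lborel (\<lambda>x. F (0 + b * x)) (Gamma s /\<^sub>R \<bar>b\<bar>)"
    using lborel_has_bochner_integral_real_affine_iff[of b F "Gamma s" 0] assms by simp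
  then have "has_bochner_integral lborel (\<lambda>x. b powr (1 - s) * F (0 + b * x))
      (b powr (1 - s) * (Gamma s /\<^sub>R \<bar>b\<bar>))"
    by (intro has_bochner_integral_mult_right)
  also have "(\<lambda>x. b powr (1 - s) * F (0 + b * x)) =
      (\<lambda>x. indicator {0<..} x * (x powr (s - 1) * exp (- (b * x))))"
  proof
    fix x
    have "b powr (1 - s) * (b * x) powr (s - 1) = x powr (s - 1)" if "0 < x"
      using that assms powr_add[of b "1 - s" "s - 1"] by (simp add: powr_mult)
    then show "b powr (1 - s) * F (0 + b * x) =
        indicator {0<..} x * (x powr (s - 1) * exp (- (b * x)))"
      using assms by (auto simp: F_def zero_less_mult_iff split: split_indicator)
  qed
  also have "b powr (1 - s) * (Gamma s /\<^sub>R \<bar>b\<bar>) = Gamma s * b powr (- s)"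
    using assms powr_add[of b 1 "- s"] by (simp add: field_simps)
  finally show ?thesis unfolding has_mellin_def .
qed

lemma has_mellin_cmult:
  assumes "has_mellin f s M"
  shows "has_mellin (\<lambda>x. c * f x) s (c * M)"
  using has_bochner_integral_mult_right[OF assms[unfolded has_mellin_def], of c]
  by (simp add: has_mellin_def mult_ac)

lemma has_mellin_diff:
  assumes "has_mellin f s M" "has_mellin g s N"
  shows "has_mellin (\<lambda>x. f x - a * g x) s (M - a * N)"
  using has_bochner_integral_diff[OF assms(1)[unfolded has_mellin_def]
      has_bochner_integral_mult_right[OF assms(2)[unfolded has_mellin_def], of a]]
  unfolding has_mellin_def by (simp add: algebra_simps)

text \<open>
  Nonnegativity turns the summability of the transforms into absolute convergence of the integrals,
  which is what justifies the exchange of sum and integral.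
\<close>

lemma has_mellin_sums:
  assumes mellin: "\<And>n. has_mellin (f n) s (M n)"
    and nonneg: "\<And>n x. 0 < x \<Longrightarrow> 0 \<le> f n x"
    and sums: "\<And>x. 0 < x \<Longrightarrow> (\<lambda>n. f n x) sums g x"
    and summable: "summable M"
  shows "has_mellin g s (suminf M)"
proof -
  define F where "F n x = indicator {0<..} x * (x powr (s - 1) * f n x)" for n x
  have F: "integrable lborel (F n)" "integral\<^sup>L lborel (F n) = M n" for n
    using mellin[of n] by (simp_all add: has_mellin_def F_def[abs_def] has_bochner_integral_iff)
  have abs_F: "\<bar>F n x\<bar> = F n x" for n x
    using nonneg[of x n] by (auto simp: F_def split: split_indicator)
  have F_sums: "(\<lambda>n. F n x) sums (indicator {0<..} x * (x powr (s - 1) * g x))" for x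
    unfolding F_def using sums[of x]
    by (cases "0 < x") (auto intro!: sums_mult)
  have "has_bochner_integral lborel (\<lambda>x. \<Sum>n. F n x) (suminf M)"
    using integrable_suminf[of lborel F] integral_suminf[of lborel F] F F_sums summable
    by (simp add: has_bochner_integral_iff abs_F sums_iff)
  then show ?thesis
    unfolding has_mellin_def using F_sums by (simp add: sums_iff)
qed

text \<open>
  By linearity the combined transform is the integral of \<open>f x / x\<close> against a combination of powers,
  so its sign is known once the latter has the sign of \<open>f\<close>. The exceptional set \<open>Z\<close> leaves room
  for the common zeros at sign changes.
\<close>

lemma has_mellin_weighted_pos:
  assumes "has_mellin f s M" "has_mellin f s' M'" "has_mellin f s'' M''"
    and nonneg: "\<And>x. 0 < x \<Longrightarrow> x \<notin> Z \<Longrightarrow>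
      0 < (c * x powr s + c' * x powr s' + c'' * x powr s'') * f x"
    and "finite Z"
  shows "0 < c * M + c' * M' + c'' * M''"
proof -
  define w where "w x = c * x powr s + c' * x powr s' + c'' * x powr s''" for x
  define F where "F x = indicator {0<..} x * (w x / x * f x)" for x
  have "has_bochner_integral lborel (\<lambda>x.
      c * (indicator {0<..} x * (x powr (s - 1) * f x)) +
      c' * (indicator {0<..} x * (x powr (s' - 1) * f x)) +
      c'' * (indicator {0<..} x * (x powr (s'' - 1) * f x))) (c * M + c' * M' + c'' * M'')"
    using assms unfolding has_mellin_def
    by (intro has_bochner_integral_add has_bochner_integral_mult_right)
  also have "(\<lambda>x. c * (indicator {0<..} x * (x powr (s - 1) * f x)) +
      c' * (indicator {0<..} x * (x powr (s' - 1) * f x)) +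
      c'' * (indicator {0<..} x * (x powr (s'' - 1) * f x))) = F"
    by (auto simp: F_def w_def fun_eq_iff powr_diff field_simps split: split_indicator)
  finally have F: "has_bochner_integral lborel F (c * M + c' * M' + c'' * M'')" .
  have pos: "0 < F x" if "0 < x" "x \<notin> Z" for x
    using nonneg[OF that] that by (simp add: F_def w_def)
  have AE_Z: "AE x in lborel. x \<notin> Z"
    using \<open>finite Z\<close> by (intro AE_not_in) (auto intro: finite_imp_null_set_lborel)
  have nn: "AE x in lborel. 0 \<le> F x"
    using AE_Z
  proof eventually_elim
    case (elim x)
    then show ?case using pos[of x] by (cases "0 < x") (auto simp: F_def)
  qed
  \<comment> \<open>Otherwise the positive function \<open>F\<close> would vanish almost everywhere on an interval.\<close>
  have "integral\<^sup>L lborel F \<noteq> 0"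
  proof
    assume "integral\<^sup>L lborel F = 0"
    then have "AE x in lborel. F x = 0"
      using integral_nonneg_eq_0_iff_AE[OF _ nn] F by (auto simp: has_bochner_integral_iff)
    with AE_Z have "AE x in lborel. x \<notin> {0<..<1::real}"
    proof eventually_elim
      case (elim x)
      then show ?case using pos[of x] by auto
    qed
    then have "emeasure lborel {0<..<1::real} = 0"
      by (subst (asm) AE_iff_measurable[where N = "{0<..<1}"]) auto
    then show False by simp
  qed
  then show ?thesis
    using F integral_nonneg_AE[OF nn] by (simp add: has_bochner_integral_iff)
qed

lemma has_mellin_pos:
  assumes "has_mellin f s M" "\<And>x. 0 < x \<Longrightarrow> 0 < f x"
  shows "0 < M"
  using has_mellin_weighted_pos[OF assms(1,1,1), of "{}" 1 0 0] assms(2) by simp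

section \<open>Log-concavity of normalised Mellin transforms\<close>

text \<open>
  Up to the factor \<open>x powr s0\<close> the combination is a function of \<open>w = x powr (s2 - s0)\<close>, namely the
  strictly concave function \<open>w powr \<theta>\<close> with \<open>\<theta> = (s1 - s0) / (s2 - s0) < 1\<close> minus its chord through
  the points that correspond to \<open>p\<close> and \<open>q\<close>, all multiplied by the length of that chord's base.
\<close>

lemma three_exponent_weight:
  fixes s0 s1 s2 p q :: real
  assumes s: "s0 < s1" "s1 < s2" and pq: "0 < p" "p < q"
  obtains A B C where "0 < B"
    "\<And>x. 0 < x \<Longrightarrow> x < p \<Longrightarrow> A * x powr s0 + B * x powr s1 + C * x powr s2 < 0"
    "\<And>x. p < x \<Longrightarrow> x < q \<Longrightarrow> 0 < A * x powr s0 + B * x powr s1 + C * x powr s2"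
    "\<And>x. q < x \<Longrightarrow> A * x powr s0 + B * x powr s1 + C * x powr s2 < 0"
proof -
  define v u where "v = s2 - s0" and "u = s1 - s0"
  define P Q where "P = p powr v" and "Q = q powr v"
  have v: "0 < v" and u: "0 < u" "u < v" using s by (auto simp: u_def v_def)
  have conc: "strictly_concave_on {0<..} (\<lambda>w. w powr (u / v))"
    using u v by (intro strictly_concave_powr) auto
  have pw: "(x powr v) powr (u / v) = x powr u" for x :: real
    using v by (simp add: powr_powr)
  define A B C where "A = P * q powr u - Q * p powr u" and "B = Q - P" and "C = p powr u - q powr u"
  define k where "k x = (Q - P) * x powr u - ((Q - x powr v) * p powr u + (x powr v - P) * q powr u)" for x
  \<comment> \<open>\<open>k\<close> is the scaled difference between \<open>w powr (u / v)\<close> and its chord, at \<open>w = x powr v\<close>.\<close>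
  have w: "A * x powr s0 + B * x powr s1 + C * x powr s2 = x powr s0 * k x" if "0 < x" for x
  proof -
    have "x powr s1 = x powr s0 * x powr u" "x powr s2 = x powr s0 * x powr v"
      by (simp_all add: u_def v_def flip: powr_add)
    then show ?thesis unfolding A_def B_def C_def k_def by (simp add: algebra_simps)
  qed
  have mono: "x powr v < y powr v" if "0 < x" "x < y" for x y
    using that v by (intro powr_less_mono2) auto
  have PQ: "0 < P" "P < Q" using pq v by (auto simp: P_def Q_def intro!: mono)
  have chord: "(z powr v - y powr v) * x powr u + (y powr v - x powr v) * z powr u
      < (z powr v - x powr v) * y powr u" if "0 < x" "x < y" "y < z" for x y z
    using strictly_concave_onD[OF conc, of "x powr v" "y powr v" "z powr v"] that mono[of x y] mono[of y z]
    by (simp add: pw)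
  show thesis
  proof
    show "0 < B" using PQ by (simp add: B_def)
    show "A * x powr s0 + B * x powr s1 + C * x powr s2 < 0" if x: "0 < x" "x < p" for x
    proof -
      have "(Q - P) * x powr u + (P - x powr v) * q powr u < (Q - x powr v) * p powr u"
        using chord[OF x pq(2)] by (simp only: P_def Q_def)
      then have "k x < 0" unfolding k_def by (simp only: left_diff_distrib)
      then show ?thesis unfolding w[OF x(1)] using x by (intro mult_pos_neg) auto
    qed
    show "0 < A * x powr s0 + B * x powr s1 + C * x powr s2" if x: "p < x" "x < q" for x
    proof -
      have "0 < x" using x pq by simp
      have "(Q - x powr v) * p powr u + (x powr v - P) * q powr u < (Q - P) * x powr u"
        using chord[OF pq(1) x] by (simp only: P_def Q_def)
      then have "0 < k x" unfolding k_def by simp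
      then show ?thesis unfolding w[OF \<open>0 < x\<close>] using \<open>0 < x\<close> by (intro mult_pos_pos) auto
    qed
    show "A * x powr s0 + B * x powr s1 + C * x powr s2 < 0" if x: "q < x" for x
    proof -
      have "0 < x" using x pq by simp
      have "(x powr v - Q) * p powr u + (Q - P) * x powr u < (x powr v - P) * q powr u"
        using chord[OF pq x] by (simp only: P_def Q_def)
      then have "k x < 0" unfolding k_def by (simp only: left_diff_distrib)
      then show ?thesis unfolding w[OF \<open>0 < x\<close>] using \<open>0 < x\<close> by (intro mult_pos_neg) auto
    qed
  qed
qed

text \<open>
  The two vanishing transforms exclude every sign pattern of \<open>d\<close> with fewer than two sign changes:
  with none, the transform at \<open>s0\<close> could not vanish; with one, at \<open>p\<close>, the weight
  \<open>x powr s2 - p powr (s2 - s0) * x powr s0\<close>, which changes sign at \<open>p\<close> only, gives a contradiction.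
  There remains the pattern \<open>-, +, -\<close>, where the weight of \<open>three_exponent_weight\<close> leaves a positive
  multiple of \<open>D\<close>.
\<close>

lemma middle_moment_pos:
  assumes s: "s0 < s1" "s1 < s2"
    and M: "has_mellin d s0 0" "has_mellin d s1 D" "has_mellin d s2 0"
    and h: "strictly_concave_on {0<..} h" and sgn: "\<And>x. 0 < x \<Longrightarrow> sgn (d x) = sgn (h x)"
  shows "0 < D"
proof -
  have dpos: "0 < d x" if "0 < x" "0 < h x" for x using sgn[OF that(1)] that(2) by (metis sgn_1_pos)
  have dneg: "d x < 0" if "0 < x" "h x < 0" for x using sgn[OF that(1)] that(2) by (metis sgn_1_neg)
  define v where "v = s2 - s0"
  have v: "0 < v" using s by (simp add: v_def)
  have mono: "x powr v < y powr v" if "0 \<le> x" "x < y" for x y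
    using that v by (intro powr_less_mono2) auto
  have split: "x powr s2 = x powr s0 * x powr v" if "0 < x" for x
    using that by (simp add: v_def flip: powr_add)
  from h show ?thesis
  proof (cases rule: strictly_concave_sign_pattern)
    case (neg p)
    have "0 < -1 * 0 + 0 * D + 0 * 0"
    proof (rule has_mellin_weighted_pos[OF M, where Z = "{p}"])
      show "0 < (- 1 * x powr s0 + 0 * x powr s1 + 0 * x powr s2) * d x" if "0 < x" "x \<notin> {p}" for x
        using dneg[of x] neg[of x] that by (simp add: mult_pos_neg)
    qed simp
    then show ?thesis by simp
  next
    case (up p)
    have "0 < - (p powr v) * 0 + 0 * D + 1 * 0"
    proof (rule has_mellin_weighted_pos[OF M, where Z = "{p}"])
      show "0 < (- (p powr v) * x powr s0 + 0 * x powr s1 + 1 * x powr s2) * d x"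
        if x: "0 < x" "x \<notin> {p}" for x
      proof -
        have "0 < (x powr v - p powr v) * d x"
        proof (cases "x < p")
          case True
          then show ?thesis using mono[of x p] dneg[of x] up(3)[of x] x by (intro mult_neg_neg) auto
        next
          case False
          then show ?thesis using mono[of p x] dpos[of x] up(1) up(2)[of x] x by (intro mult_pos_pos) auto
        qed
        then have "0 < x powr s0 * ((x powr v - p powr v) * d x)" using x by simp
        then show ?thesis using x by (simp add: split algebra_simps)
      qed
    qed simp
    then show ?thesis by simp
  next
    case (down q)
    have "0 < (q powr v) * 0 + 0 * D + (- 1) * 0"
    proof (rule has_mellin_weighted_pos[OF M, where Z = "{q}"])
      show "0 < ((q powr v) * x powr s0 + 0 * x powr s1 + (- 1) * x powr s2) * d x"
        if x: "0 < x" "x \<notin> {q}" for x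
      proof -
        have "0 < (q powr v - x powr v) * d x"
        proof (cases "x < q")
          case True
          then show ?thesis using mono[of x q] dpos[of x] down(2)[of x] x by (intro mult_pos_pos) auto
        next
          case False
          then show ?thesis using mono[of q x] dneg[of x] down(1) down(3)[of x] x by (intro mult_neg_neg) auto
        qed
        then have "0 < x powr s0 * ((q powr v - x powr v) * d x)" using x by simp
        then show ?thesis using x by (simp add: split algebra_simps)
      qed
    qed simp
    then show ?thesis by simp
  next
    case (bump p q)
    obtain A B C where w: "0 < B"
      "\<And>x. 0 < x \<Longrightarrow> x < p \<Longrightarrow> A * x powr s0 + B * x powr s1 + C * x powr s2 < 0"
      "\<And>x. p < x \<Longrightarrow> x < q \<Longrightarrow> 0 < A * x powr s0 + B * x powr s1 + C * x powr s2"
      "\<And>x. q < x \<Longrightarrow> A * x powr s0 + B * x powr s1 + C * x powr s2 < 0"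
      by (rule three_exponent_weight[OF s bump(1,2)]) (rule that; blast)
    have "0 < A * 0 + B * D + C * 0"
    proof (rule has_mellin_weighted_pos[OF M, where Z = "{p, q}"])
      show "0 < (A * x powr s0 + B * x powr s1 + C * x powr s2) * d x"
        if x: "0 < x" "x \<notin> {p, q}" for x
      proof -
        consider "x < p" | "p < x" "x < q" | "q < x" using x by fastforce
        then show ?thesis
        proof cases
          case 1
          then show ?thesis using w(2) dneg bump(4) x by (intro mult_neg_neg) auto
        next
          case 2
          then show ?thesis using w(3) dpos bump(3) x by (intro mult_pos_pos) auto
        next
          case 3
          then show ?thesis using w(4) dneg bump(5) x by (intro mult_neg_neg) auto
        qed
      qed
    qed simp
    then show ?thesis using w(1) by (simp add: zero_less_mult_iff)
  qed
qed

text \<open>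
  This is a strict form of Borell's theorem. The comparison function \<open>a * exp (- b * x)\<close> is
  determined by the requirement that its transform divided by \<open>Gamma\<close>, which is \<open>a * b powr (- s)\<close>,
  agree with that of \<open>f\<close> at \<open>s0\<close> and \<open>s2\<close>; then \<open>f\<close> minus the comparison function has the sign of
  \<open>ln f\<close> plus an affine function, and \<open>middle_moment_pos\<close> applies.
\<close>

lemma mellin_over_Gamma_strictly_log_concave:
  assumes pos: "\<And>x. 0 < x \<Longrightarrow> 0 < f x"
    and conc: "strictly_concave_on {0<..} (\<lambda>x. ln (f x))"
    and S: "S \<subseteq> {0<..}" and M: "\<And>s. s \<in> S \<Longrightarrow> has_mellin f s (M s)"
  shows "strictly_concave_on S (\<lambda>s. ln (M s / Gamma s))"
  unfolding strictly_concave_on_def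
proof (intro ballI impI)
  fix s0 s1 s2
  assume sS: "s0 \<in> S" "s1 \<in> S" "s2 \<in> S" and s: "s0 < s1" "s1 < s2"
  define N where "N s = M s / Gamma s" for s
  have Npos: "0 < N s" if "s \<in> S" for s
    using has_mellin_pos[OF M[OF that] pos] S that by (auto simp: N_def intro!: divide_pos_pos Gamma_real_pos)
  \<comment> \<open>\<open>- L\<close> is the slope of the chord of \<open>ln N\<close> from \<open>s0\<close> to \<open>s2\<close>, so \<open>a * b powr - s\<close> is the
    exponential of that chord.\<close>
  define L where "L = (ln (N s0) - ln (N s2)) / (s2 - s0)"
  define b where "b = exp L"
  define a where "a = N s0 * b powr s0"
  have b: "0 < b" and a: "0 < a" using Npos sS by (auto simp: b_def a_def)
  have ln_a: "ln a = ln (N s0) + s0 * L" using Npos[OF sS(1)] by (simp add: a_def b_def ln_mult ln_powr)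
  have ab: "ln (a * b powr - s) = ln a - s * L" for s using a b by (simp add: ln_mult ln_powr b_def)
  have "(s2 - s0) * L = ln (N s0) - ln (N s2)" using s by (simp add: L_def)
  then have "ln (a * b powr - s2) = ln (N s2)" "ln (a * b powr - s0) = ln (N s0)"
    unfolding ab ln_a by (simp_all add: algebra_simps)
  then have match: "a * b powr - s2 = N s2" "a * b powr - s0 = N s0"
    using a b Npos sS by simp_all
  define d where "d x = f x - a * exp (- (b * x))" for x
  have Md: "has_mellin d s (Gamma s * (N s - a * b powr - s))" if "s \<in> S" for s
  proof -
    have "0 < s" using that S by auto
    then have "Gamma s \<noteq> 0" using Gamma_real_pos[OF \<open>0 < s\<close>] by linarith
    then show ?thesis
      using has_mellin_diff[OF M[OF that] has_mellin_exp[OF \<open>0 < s\<close> b], of a]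
      by (simp add: d_def[abs_def] N_def algebra_simps)
  qed
  have "0 < Gamma s1 * (N s1 - a * b powr - s1)"
  proof (rule middle_moment_pos[OF s])
    show "has_mellin d s0 0" "has_mellin d s2 0" using Md[OF sS(1)] Md[OF sS(3)] match by simp_all
    show "has_mellin d s1 (Gamma s1 * (N s1 - a * b powr - s1))" by (rule Md) fact
    show "strictly_concave_on {0<..} (\<lambda>x. ln (f x) + (b * x + - ln a))"
      by (rule strictly_concave_on_add_affine[OF conc])
    show "sgn (d x) = sgn (ln (f x) + (b * x + - ln a))" if "0 < x" for x
    proof -
      have "ln (a * exp (- (b * x))) = ln a - b * x" using a by (simp add: ln_mult)
      then have "ln (f x) + (b * x + - ln a) = ln (f x) - ln (a * exp (- (b * x)))" by simp
      moreover have "sgn (ln u - ln w) = sgn (u - w)" if "0 < u" "0 < w" for u w :: real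
        using that by (auto simp: sgn_if)
      ultimately show ?thesis using pos[OF that] a by (simp add: d_def)
    qed
  qed
  moreover have "0 < Gamma s1" using S sS by (auto intro: Gamma_real_pos)
  ultimately have "a * b powr - s1 < N s1" by (simp add: zero_less_mult_iff)
  then have "ln (a * b powr - s1) < ln (N s1)" using a b Npos[OF sS(2)] by (subst ln_less_cancel_iff) auto
  then have *: "(s2 - s0) * (ln a - s1 * L) < (s2 - s0) * ln (N s1)" unfolding ab using s by simp
  have "(s2 - s1) * ln (N s0) + (s1 - s0) * ln (N s2) = (s2 - s0) * (ln a - s1 * L)"
    unfolding ln_a using \<open>(s2 - s0) * L = ln (N s0) - ln (N s2)\<close>
    by algebra
  with * show "(s2 - s1) * ln (M s0 / Gamma s0) + (s1 - s0) * ln (M s2 / Gamma s2)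
      < (s2 - s0) * ln (M s1 / Gamma s1)"
    by (simp add: N_def)
qed

section \<open>The zeta function as a normalised Mellin transform\<close>

lemma summable_zeta_series: "1 < s \<Longrightarrow> summable (\<lambda>n. real (Suc n) powr - s)"
  using summable_real_powr_iff[of "- s"] by (subst summable_Suc_iff) simp

lemma zeta_eq_suminf_powr: "zeta s = (\<Sum>n. real (Suc n) powr - s)"
  by (simp add: zeta_def powr_minus field_simps)

text \<open>
  The differentiated series converges uniformly on a half-line \<open>{s'<..}\<close> with \<open>1 < s' < s\<close>: the
  logarithm costs only an arbitrarily small power of \<open>n\<close>.
\<close>

lemma has_field_derivative_zeta:
  assumes "1 < s"
  shows "(zeta has_field_derivative deriv zeta s) (at s)"
proof -
  define s' where "s' = (1 + s) / 2"
  define \<epsilon> where "\<epsilon> = (s' - 1) / 2"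
  have s': "1 < s'" "s' < s" and \<epsilon>: "0 < \<epsilon>" "\<epsilon> - s' < -1" using assms by (auto simp: s'_def \<epsilon>_def field_simps)
  \<comment> \<open>\<open>ln n \<le> n powr \<epsilon> / \<epsilon>\<close>, and \<open>\<epsilon>\<close> is small enough to keep the exponent \<open>s' - \<epsilon>\<close> above \<open>1\<close>.\<close>
  have bound: "norm (- ln (real (Suc n)) * real (Suc n) powr - x) \<le> (1 / \<epsilon>) * real (Suc n) powr (\<epsilon> - s')"
    if "x \<in> {s'<..}" for n x
  proof -
    have "ln (real (Suc n)) * real (Suc n) powr - x \<le> (real (Suc n) powr \<epsilon> / \<epsilon>) * real (Suc n) powr - s'"
      using that \<epsilon> by (intro mult_mono ln_powr_bound powr_mono) auto
    then show ?thesis by (simp add: abs_mult powr_diff powr_minus field_simps)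
  qed
  have "((\<lambda>x. \<Sum>n. real (Suc n) powr - x) has_field_derivative
      (\<Sum>n. - ln (real (Suc n)) * real (Suc n) powr - s)) (at s)"
  proof (rule has_field_derivative_series'(2)[where S = "{s'<..}"])
    show "((\<lambda>x. real (Suc n) powr - x) has_field_derivative - ln (real (Suc n)) * real (Suc n) powr - x)
        (at x within {s'<..})" for n x
      by (rule has_field_derivative_at_within) (auto intro!: derivative_eq_intros simp del: of_nat_Suc)
    show "uniformly_convergent_on {s'<..} (\<lambda>n x. \<Sum>i<n. - ln (real (Suc i)) * real (Suc i) powr - x)"
      using bound summable_zeta_series[of "s' - \<epsilon>"] \<epsilon>(2)
      by (intro Weierstrass_m_test'[where M = "\<lambda>n. (1 / \<epsilon>) * real (Suc n) powr (\<epsilon> - s')"])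
         (auto intro: summable_mult)
    show "summable (\<lambda>n. real (Suc n) powr - s)" by (rule summable_zeta_series) fact
  qed (use s' in \<open>auto simp: interior_open\<close>)
  then have "(zeta has_field_derivative (\<Sum>n. - ln (real (Suc n)) * real (Suc n) powr - s)) (at s)"
    by (subst zeta_eq_suminf_powr[abs_def])
  then show ?thesis by (simp add: DERIV_imp_deriv)
qed

text \<open>This is \<open>- (d/dx) (x / (exp x - 1))\<close>.\<close>

definition zeta_kernel :: "real \<Rightarrow> real" where
  "zeta_kernel x = (exp x * (x - 1) + 1) / (exp x - 1)\<^sup>2"

text \<open>
  The kernel is \<open>x * A x - B x\<close>, where \<open>B x\<close> is the sum of \<open>exp (- n * x)\<close> and \<open>A x\<close> the sum of
  \<open>n * exp (- n * x)\<close> over \<open>n \<ge> 1\<close>. Their termwise transforms at \<open>s\<close> give \<open>Gamma s * zeta s\<close> for \<open>B\<close>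
  and, the factor \<open>x\<close> shifting \<open>s\<close> to \<open>s + 1\<close>, \<open>Gamma (s + 1) * zeta s = s * Gamma s * zeta s\<close> for
  \<open>x * A x\<close>. The two parts are summed separately because each has nonnegative terms.
\<close>

lemma has_mellin_zeta_kernel:
  assumes s: "1 < s"
  shows "has_mellin zeta_kernel s (Gamma s * ((s - 1) * zeta s))"
proof -
  define B where "B x = 1 / (exp x - 1)" for x :: real
  define A where "A x = exp x / (exp x - 1)\<^sup>2" for x :: real
  have B: "has_mellin B s (\<Sum>n. Gamma s * real (Suc n) powr - s)"
  proof (rule has_mellin_sums)
    show "has_mellin (\<lambda>x. exp (- (real (Suc n) * x))) s (Gamma s * real (Suc n) powr - s)" for n
      by (rule has_mellin_exp) (use s in auto)
    show "summable (\<lambda>n. Gamma s * real (Suc n) powr - s)"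
      by (intro summable_mult summable_zeta_series s)
    show "(\<lambda>n. exp (- (real (Suc n) * x))) sums B x" if "0 < x" for x
    proof -
      have "(\<lambda>n. exp (- x) * exp (- x) ^ n) sums (exp (- x) * (1 / (1 - exp (- x))))"
        by (intro sums_mult geometric_sums) (use that in auto)
      also have "exp (- x) * (1 / (1 - exp (- x))) = B x"
        using that by (simp add: B_def exp_minus field_simps)
      also have "(\<lambda>n. exp (- x) * exp (- x) ^ n) = (\<lambda>n. exp (- (real (Suc n) * x)))"
        by (simp add: fun_eq_iff algebra_simps flip: exp_of_nat_mult exp_add)
      finally show ?thesis .
    qed
  qed simp
  have A: "has_mellin A (s + 1) (\<Sum>n. Gamma (s + 1) * real (Suc n) powr - s)"
  proof (rule has_mellin_sums)
    show "has_mellin (\<lambda>x. real (Suc n) * exp (- (real (Suc n) * x))) (s + 1)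
        (Gamma (s + 1) * real (Suc n) powr - s)" for n
    proof -
      have "real (Suc n) * real (Suc n) powr - (s + 1) = real (Suc n) powr - s"
        using powr_add[of "real (Suc n)" 1 "- (s + 1)"] by simp
      then have "real (Suc n) * (Gamma (s + 1) * real (Suc n) powr - (s + 1))
          = Gamma (s + 1) * real (Suc n) powr - s"
        by (simp only: mult.left_commute[of "real (Suc n)"])
      moreover have "has_mellin (\<lambda>x. real (Suc n) * exp (- (real (Suc n) * x))) (s + 1)
          (real (Suc n) * (Gamma (s + 1) * real (Suc n) powr - (s + 1)))"
        by (intro has_mellin_cmult has_mellin_exp) (use s in auto)
      ultimately show ?thesis by (simp only:)
    qed
    show "summable (\<lambda>n. Gamma (s + 1) * real (Suc n) powr - s)"
      by (intro summable_mult summable_zeta_series s)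
    show "(\<lambda>n. real (Suc n) * exp (- (real (Suc n) * x))) sums A x" if "0 < x" for x
    proof -
      have "(\<lambda>n. exp (- x) * (of_nat (Suc n) * exp (- x) ^ n)) sums (exp (- x) * (1 / (1 - exp (- x))\<^sup>2))"
        by (intro sums_mult geometric_deriv_sums) (use that in auto)
      also have "exp (- x) * (1 / (1 - exp (- x))\<^sup>2) = A x"
        using that by (simp add: A_def exp_minus field_simps power2_eq_square)
      also have "(\<lambda>n. exp (- x) * (of_nat (Suc n) * exp (- x) ^ n)) =
          (\<lambda>n. real (Suc n) * exp (- (real (Suc n) * x)))"
        by (simp add: fun_eq_iff algebra_simps flip: exp_of_nat_mult exp_add)
      finally show ?thesis .
    qed
  qed simp
  have xA: "has_mellin (\<lambda>x. x * A x) s (\<Sum>n. Gamma (s + 1) * real (Suc n) powr - s)"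
    using A by (subst has_mellin_cong[of _ _ "s + 1" A]) (auto simp: powr_diff)
  have kernel_eq: "x * A x - 1 * B x = zeta_kernel x" if "0 < x" for x
    using that by (simp add: zeta_kernel_def A_def B_def power2_eq_square divide_simps) (simp add: algebra_simps)
  have Gam: "Gamma (1 + s) = s * Gamma s"
    unfolding add.commute[of 1 s] by (rule Gamma_plus1) (use s in auto)
  have "has_mellin (\<lambda>x. x * A x - 1 * B x) s (Gamma s * ((s - 1) * zeta s))"
    using has_mellin_diff[OF xA B, of 1] summable_zeta_series[OF s]
    by (simp add: zeta_eq_suminf_powr Gam suminf_mult algebra_simps)
  then show ?thesis using kernel_eq
    by (subst has_mellin_cong[of s zeta_kernel s "\<lambda>x. x * A x - 1 * B x"]) auto
qed

section \<open>Log-concavity of the kernel\<close>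

lemma pos_if_deriv_pos:
  fixes f f' :: "real \<Rightarrow> real"
  assumes "f 0 = 0" "\<And>x. (f has_field_derivative f' x) (at x)" "\<And>x. 0 < x \<Longrightarrow> 0 < f' x" "0 < x"
  shows "0 < f x"
proof -
  obtain \<xi> where "0 < \<xi>" "f x - f 0 = (x - 0) * f' \<xi>" using MVT2[of 0 x f f'] assms by auto
  then show ?thesis using assms by simp
qed

lemma exp_mult_pred_plus_1_pos:
  assumes "0 < (x::real)" shows "0 < exp x * (x - 1) + 1"
  by (rule pos_if_deriv_pos[where f' = "\<lambda>x. x * exp x"])
    (use assms in \<open>auto intro!: derivative_eq_intros simp: algebra_simps\<close>)

lemma zeta_kernel_pos: "0 < x \<Longrightarrow> 0 < zeta_kernel x"
  using exp_mult_pred_plus_1_pos[of x] by (simp add: zeta_kernel_def)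

text \<open>
  This is the negativity of the second derivative of the logarithm of the kernel, cleared of denominators. Both sides
  agree to fifth order at \<open>0\<close>. Their difference is the exponential polynomial \<open>f0\<close> with frequencies
  \<open>0\<close> to \<open>3\<close>. Two derivatives remove its polynomial part; after division by \<open>exp x\<close>, two more remove
  the next one. All functions in this chain vanish at \<open>0\<close>, so the positivity of the last one, which
  is elementary, passes back to \<open>f0\<close>.
\<close>

lemma zeta_kernel_log_concavity_inequality:
  assumes "0 < (x::real)"
  shows "2 * (exp x * (x - 1) + 1)\<^sup>2 < (exp x - 1 - x) * (exp x - 1)\<^sup>2"
proof -
  \<comment> \<open>\<open>f1\<close> is the derivative of \<open>f0\<close>, and that of \<open>f1\<close> is \<open>exp x * g0 x\<close>;
    \<open>g1\<close> and \<open>g2\<close> are the first two derivatives of \<open>g0\<close>.\<close>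
  define g2 where "g2 x = 36 * exp (2 * x) + exp x * (- 8 * x\<^sup>2 - 36 * x - 36)" for x :: real
  define g1 where "g1 x = 18 * exp (2 * x) + exp x * (- 8 * x\<^sup>2 - 20 * x - 16) - 2" for x :: real
  define g0 where "g0 x = 9 * exp (2 * x) + exp x * (- 8 * x\<^sup>2 - 4 * x - 12) + 3 - 2 * x" for x :: real
  define f1 where "f1 x = 3 * exp (3 * x) + exp (2 * x) * (- 4 * x\<^sup>2 + 2 * x - 7) + exp x * (5 - 2 * x) - 1" for x :: real
  define f0 where "f0 x = exp (3 * x) + exp (2 * x) * (- 2 * x\<^sup>2 + 3 * x - 5) + exp x * (7 - 2 * x) - (x + 3)" for x :: real
  have e2: "exp (2 * x) = exp x * exp x" and e3: "exp (3 * x) = exp x * exp x * exp x" for x :: real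
    by (simp_all flip: exp_add)
  \<comment> \<open>Up to the factor \<open>exp x\<close>, this is \<open>36 * exp x\<close> against a quadratic polynomial.\<close>
  have g2: "0 < g2 x" if "0 < x" for x
  proof -
    have "0 < exp x * (36 * (exp x - (1 + x + x\<^sup>2 / 2)) + 10 * x\<^sup>2)"
      using exp_lower_Taylor_quadratic[of x] that by (intro mult_pos_pos add_nonneg_pos) auto
    also have "\<dots> = g2 x" unfolding g2_def e2 by (simp add: algebra_simps)
    finally show ?thesis .
  qed
  have "(g1 has_field_derivative g2 x) (at x)" for x
    unfolding g1_def[abs_def] g2_def by (auto intro!: derivative_eq_intros simp: algebra_simps)
  then have g1: "0 < g1 x" if "0 < x" for x
    by (rule pos_if_deriv_pos[rotated]) (use g2 that in \<open>auto simp: g1_def\<close>)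
  have "(g0 has_field_derivative g1 x) (at x)" for x
    unfolding g0_def[abs_def] g1_def by (auto intro!: derivative_eq_intros simp: algebra_simps)
  then have g0: "0 < g0 x" if "0 < x" for x
    by (rule pos_if_deriv_pos[rotated]) (use g1 that in \<open>auto simp: g0_def\<close>)
  have "(f1 has_field_derivative 9 * exp (3 * x) + exp (2 * x) * (- 8 * x\<^sup>2 - 4 * x - 12)
      + exp x * (3 - 2 * x)) (at x)" for x
    unfolding f1_def[abs_def] by (auto intro!: derivative_eq_intros simp: algebra_simps)
  moreover have "9 * exp (3 * x) + exp (2 * x) * (- 8 * x\<^sup>2 - 4 * x - 12) + exp x * (3 - 2 * x)
      = exp x * g0 x" for x
    unfolding g0_def e2 e3 by (simp add: algebra_simps)
  ultimately have "(f1 has_field_derivative exp x * g0 x) (at x)" for x by simp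
  then have f1: "0 < f1 x" if "0 < x" for x
    by (rule pos_if_deriv_pos[rotated]) (use g0 that in \<open>auto simp: f1_def\<close>)
  have "(f0 has_field_derivative f1 x) (at x)" for x
    unfolding f0_def[abs_def] f1_def by (auto intro!: derivative_eq_intros simp: algebra_simps)
  then have f0: "0 < f0 x" if "0 < x" for x
    by (rule pos_if_deriv_pos[rotated]) (use f1 that in \<open>auto simp: f0_def\<close>)
  have "(exp x - 1 - x) * (exp x - 1)\<^sup>2 - 2 * (exp x * (x - 1) + 1)\<^sup>2 = f0 x"
    unfolding f0_def e2 e3 by (simp add: algebra_simps power2_eq_square)
  then show ?thesis using f0[OF assms] by simp
qed

lemma zeta_kernel_strictly_log_concave: "strictly_concave_on {0<..} (\<lambda>x. ln (zeta_kernel x))"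
proof -
  define p where "p x = exp x * (x - 1) + 1" for x :: real
  define l' where "l' x = x * exp x / p x - 2 * exp x / (exp x - 1)" for x
  define l'' where "l'' x = exp x * (1 + x - exp x) / (p x)\<^sup>2 + 2 * exp x / (exp x - 1)\<^sup>2" for x
  have p: "0 < p x" if "0 < x" for x unfolding p_def by (rule exp_mult_pred_plus_1_pos[OF that])
  have p': "(p has_field_derivative x * exp x) (at x)" for x
    unfolding p_def[abs_def] by (auto intro!: derivative_eq_intros simp: algebra_simps)
  have "strictly_concave_on {0<..} (\<lambda>x. ln (p x) - 2 * ln (exp x - 1))"
  proof (rule strictly_concave_on_deriv)
    show "((\<lambda>x. ln (p x) - 2 * ln (exp x - 1)) has_field_derivative l' x) (at x)" if "0 < x" for x
      using p[OF that] that
      by (auto intro!: derivative_eq_intros p' simp: l'_def field_simps)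
    have l'': "(l' has_field_derivative l'' x) (at x)" if "0 < x" for x
    proof -
      have e: "exp x - 1 \<noteq> 0" using that by simp
      have "((\<lambda>x. x * exp x / p x) has_field_derivative
          ((1 * exp x + exp x * x) * p x - x * exp x * (x * exp x)) / (p x * p x)) (at x)"
        using p[OF that] by (intro DERIV_divide DERIV_mult DERIV_ident DERIV_exp p') auto
      moreover have "((\<lambda>x. 2 * exp x / (exp x - 1)) has_field_derivative
          (2 * exp x * (exp x - 1) - 2 * exp x * (exp x - 0)) / ((exp x - 1) * (exp x - 1))) (at x)"
        using e by (intro DERIV_divide DERIV_cmult DERIV_diff DERIV_exp DERIV_const) auto
      ultimately have "(l' has_field_derivative
          ((1 * exp x + exp x * x) * p x - x * exp x * (x * exp x)) / (p x * p x)
          - (2 * exp x * (exp x - 1) - 2 * exp x * (exp x - 0)) / ((exp x - 1) * (exp x - 1))) (at x)"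
        unfolding l'_def[abs_def] by (rule DERIV_diff)
      also have "((1 * exp x + exp x * x) * p x - x * exp x * (x * exp x)) = exp x * (1 + x - exp x)"
        by (simp add: p_def algebra_simps)
      also have "2 * exp x * (exp x - 1) - 2 * exp x * (exp x - 0) = - (2 * exp x)"
        by (simp add: algebra_simps)
      finally show ?thesis by (simp add: l''_def power2_eq_square)
    qed
    have neg: "l'' x < 0" if "0 < x" for x
    proof -
      have "0 < exp x - 1" using that by simp
      then have "l'' x = (exp x * (1 + x - exp x) * (exp x - 1)\<^sup>2 + 2 * exp x * (p x)\<^sup>2)
          / ((p x)\<^sup>2 * (exp x - 1)\<^sup>2)"
        using p[OF that] by (simp add: l''_def add_frac_eq)
      also have "exp x * (1 + x - exp x) * (exp x - 1)\<^sup>2 + 2 * exp x * (p x)\<^sup>2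
          = - exp x * ((exp x - 1 - x) * (exp x - 1)\<^sup>2 - 2 * (p x)\<^sup>2)"
        by (simp add: algebra_simps)
      finally have l''_eq: "l'' x = - exp x * ((exp x - 1 - x) * (exp x - 1)\<^sup>2 - 2 * (p x)\<^sup>2)
          / ((p x)\<^sup>2 * (exp x - 1)\<^sup>2)" .
      show ?thesis unfolding l''_eq
        using zeta_kernel_log_concavity_inequality[OF that] p[OF that] \<open>0 < exp x - 1\<close> unfolding p_def[symmetric]
        by (intro divide_neg_pos mult_neg_pos mult_pos_pos) auto
    qed
    show "l' y < l' x" if "0 < x" "x < y" for x y
    proof (rule DERIV_neg_imp_decreasing[OF that(2)])
      fix u assume "x \<le> u"
      with that have "0 < u" by simp
      then show "\<exists>D. (l' has_field_derivative D) (at u) \<and> D < 0" using l'' neg by blast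
    qed
  qed
  moreover have "ln (zeta_kernel x) = ln (p x) - 2 * ln (exp x - 1)" if "0 < x" for x
    using p[OF that] that by (simp add: zeta_kernel_def ln_div ln_realpow flip: p_def)
  ultimately show ?thesis by (simp add: strictly_concave_on_def)
qed

section \<open>Monotonicity of the logarithmic derivative\<close>

theorem theorem5:
  "strict_antimono_on {1<..} (\<lambda>s::real. deriv zeta s / zeta s + 1 / (s - 1))"
proof (rule strictly_concave_deriv_strict_antimono)
  have "strictly_concave_on {1<..} (\<lambda>s. ln (Gamma s * ((s - 1) * zeta s) / Gamma s))"
    by (rule mellin_over_Gamma_strictly_log_concave[OF zeta_kernel_pos zeta_kernel_strictly_log_concave])
      (use has_mellin_zeta_kernel in auto)
  moreover have "Gamma s \<noteq> 0" if "1 < s" for s :: real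
    using Gamma_real_pos[of s] that by linarith
  ultimately show "strictly_concave_on {1<..} (\<lambda>s. ln ((s - 1) * zeta s))"
    by (simp add: strictly_concave_on_def)
  show "((\<lambda>s. ln ((s - 1) * zeta s)) has_field_derivative deriv zeta s / zeta s + 1 / (s - 1)) (at s)"
    if "s \<in> {1<..}" for s
  proof -
    have s: "1 < s" using that by simp
    have "0 < zeta s" unfolding zeta_eq_suminf_powr by (rule suminf_pos[OF summable_zeta_series[OF s]]) simp
    then show ?thesis
      using s by (auto intro!: derivative_eq_intros has_field_derivative_zeta simp: field_simps)
  qed
qed auto

end
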